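(* In the logistic regression model, suppose that the linear restrictions $H\beta=h$ hold, and let $0<d<1$. Then the matrix mean squared error of the restricted almost unbiased Liu estimator $\hat\beta_{RAULE}=L_d\hat\beta_{RMLE}$ is $$MMSE(\hat\beta_{RAULE})=L_dAL_d+(L_d-I)\beta\beta'(L_d-I)',$$ where $L_d=I-(1-d)^2(C+I)^{-2}$ and $A=C^{-1}-C^{-1}H'(HC^{-1}H')^{-1}HC^{-1}$.
   Context: Logistic regression model: $y_i=\pi_i+\varepsilon_i$, $i=1,\dots,n$, with $y_i$ Bernoulli of parameter $\pi_i=\exp(x_i'\beta)/(1+\exp(x_i'\beta))$, where $\beta\in\mathbb{R}^{p+1}$ is the unknown coefficient vector and $x_i'$ is the $i$th row of the $n\times(p+1)$ data matrix $X$. A prime denotes transpose. Let $C=X'\hat WX$, where $\hat W=\mathrm{Diag}(\hat\pi_i(1-\hat\pi_i))$. Convention (usual large-sample treatment): $C$ is a fixed symmetric positive definite $(p+1)\times(p+1)$ matrix, and the maximum likelihood estimator $\hat\beta_{MLE}$ is a random vector in $\mathbb{R}^{p+1}$ with $E(\hat\beta_{MLE})=\beta$ and $Cov(\hat\beta_{MLE})=C^{-1}$; no other property of the model is used. $H$ is a known $q\times(p+1)$ matrix of full row rank $q\le p+1$, and $h\in\mathbb{R}^q$ is a known vector. The restricted MLE is $$\hat\beta_{RMLE}=\hat\beta_{MLE}-C^{-1}H'(HC^{-1}H')^{-1}(H\hat\beta_{MLE}-h).$$ For an estimator $\hat\theta$ of a parameter $\theta$, $Bias(\hat\theta)=E(\hat\theta)-\theta$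 and $MMSE(\hat\theta)=E[(\hat\theta-\theta)(\hat\theta-\theta)']=Cov(\hat\theta)+Bias(\hat\theta)Bias(\hat\theta)'$. *)

theory Defs
  imports "HOL-Analysis.Analysis" "HOL-Probability.Probability"
begin

definition sym_pos_def :: "real^'k^'k \<Rightarrow> bool" where
  "sym_pos_def C \<longleftrightarrow> transpose C = C \<and> (\<forall>x. x \<noteq> 0 \<longrightarrow> 0 < x \<bullet> (C *v x))"

definition outer :: "real^'m \<Rightarrow> real^'n \<Rightarrow> real^'n^'m" where
  "outer x y = (\<chi> i j. x $ i * y $ j)"

text \<open>A random vector with finite second moments. This is what makes the mean vector and
  the covariance matrix meaningful: the Bochner integral of a non-integrable function is 0.\<close>

definition square_integrable_rv :: "'w measure \<Rightarrow> ('w \<Rightarrow> real^'k) \<Rightarrow> bool" where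
  "square_integrable_rv M X \<longleftrightarrow>
     X \<in> borel_measurable M \<and> integrable M (\<lambda>\<omega>. (norm (X \<omega>))\<^sup>2)"

definition cov_matrix :: "'w measure \<Rightarrow> ('w \<Rightarrow> real^'k) \<Rightarrow> real^'k^'k" where
  "cov_matrix M X =
     (\<integral>\<omega>. outer (X \<omega> - (\<integral>\<eta>. X \<eta> \<partial>M)) (X \<omega> - (\<integral>\<eta>. X \<eta> \<partial>M)) \<partial>M)"

definition bias :: "'w measure \<Rightarrow> ('w \<Rightarrow> real^'k) \<Rightarrow> real^'k \<Rightarrow> real^'k" where
  "bias M T \<theta> = (\<integral>\<omega>. T \<omega> \<partial>M) - \<theta>"

definition mmse :: "'w measure \<Rightarrow> ('w \<Rightarrow> real^'k) \<Rightarrow> real^'k \<Rightarrow> real^'k^'k" where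
  "mmse M T \<theta> = (\<integral>\<omega>. outer (T \<omega> - \<theta>) (T \<omega> - \<theta>) \<partial>M)"

definition rmle :: "real^'k^'k \<Rightarrow> real^'k^'q \<Rightarrow> real^'q \<Rightarrow> real^'k \<Rightarrow> real^'k" where
  "rmle C H h b =
     b - (matrix_inv C ** transpose H ** matrix_inv (H ** matrix_inv C ** transpose H))
           *v (H *v b - h)"

text \<open>The products below are written with \<open>**\<close> because powers and \<open>*\<close> on the vector type
  are componentwise.\<close>

definition raule_factor :: "real^'k^'k \<Rightarrow> real \<Rightarrow> real^'k^'k" where
  "raule_factor C d =
     mat 1 - (1 - d)\<^sup>2 *\<^sub>R (matrix_inv (C + mat 1) ** matrix_inv (C + mat 1))"

definition raule :: "real^'k^'k \<Rightarrow> real^'k^'q \<Rightarrow> real^'q \<Rightarrow> real \<Rightarrow> real^'k \<Rightarrow> real^'k" where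
  "raule C H h d b = raule_factor C d *v rmle C H h b"

definition restr_cov :: "real^'k^'k \<Rightarrow> real^'k^'q \<Rightarrow> real^'k^'k" where
  "restr_cov C H =
     matrix_inv C -
     matrix_inv C ** transpose H ** matrix_inv (H ** matrix_inv C ** transpose H)
       ** H ** matrix_inv C"

text \<open>The two usual expressions for the matrix mean squared error agree.\<close>

lemma integrable_outer:
  fixes X Y :: "'w \<Rightarrow> real^'k"
  assumes "square_integrable_rv M X" "square_integrable_rv M Y"
  shows "integrable M (\<lambda>\<omega>. outer (X \<omega>) (Y \<omega>))"
proof (rule Bochner_Integration.integrable_bound)
  have m [measurable]: "X \<in> borel_measurable M" "Y \<in> borel_measurable M"
    using assms by (auto simp: square_integrable_rv_def)
  show "integrable M (\<lambda>\<omega>. real CARD('k) * (real CARD('k) * ((norm (X \<omega>))\<^sup>2 + (norm (Y \<omega>))\<^sup>2)))"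
    using assms by (auto simp: square_integrable_rv_def)
  have c: "continuous_on UNIV (\<lambda>p::(real^'k) \<times> (real^'k). outer (fst p) (snd p))"
    unfolding outer_def by (intro continuous_intros)
  have "(\<lambda>\<omega>. outer (fst (X \<omega>, Y \<omega>)) (snd (X \<omega>, Y \<omega>))) \<in> borel_measurable M"
    by (rule borel_measurable_continuous_on[OF c]) measurable
  then show "(\<lambda>\<omega>. outer (X \<omega>) (Y \<omega>)) \<in> borel_measurable M" by simp
  have entry: "\<bar>x $ i * y $ j\<bar> \<le> (norm x)\<^sup>2 + (norm y)\<^sup>2" for x y :: "real^'k" and i j
  proof -
    have "\<bar>x $ i * y $ j\<bar> \<le> norm x * norm y"
      by (auto simp: abs_mult intro!: mult_mono component_le_norm_cart)
    also have "\<dots> \<le> (norm x)\<^sup>2 + (norm y)\<^sup>2"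
      using sum_squares_bound[of "norm x" "norm y"]
            mult_nonneg_nonneg[OF norm_ge_zero[of x] norm_ge_zero[of y]] by linarith
    finally show ?thesis .
  qed
  have "norm (outer x y) \<le> real CARD('k) * (real CARD('k) * ((norm x)\<^sup>2 + (norm y)\<^sup>2))"
    for x y :: "real^'k"
  proof -
    have row: "norm (outer x y $ i) \<le> real CARD('k) * ((norm x)\<^sup>2 + (norm y)\<^sup>2)" for i
      using norm_le_l1_cart[of "outer x y $ i"]
            sum_bounded_above[of UNIV "\<lambda>j. \<bar>outer x y $ i $ j\<bar>" "(norm x)\<^sup>2 + (norm y)\<^sup>2"] entry
      by (force simp: outer_def)
    have "norm (outer x y) \<le> (\<Sum>i\<in>UNIV. norm (outer x y $ i))"
      unfolding norm_vec_def by (rule L2_set_le_sum) simp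
    also have "\<dots> \<le> real CARD('k) * (real CARD('k) * ((norm x)\<^sup>2 + (norm y)\<^sup>2))"
      using sum_bounded_above[of UNIV "\<lambda>i. norm (outer x y $ i)", OF row] by simp
    finally show ?thesis .
  qed
  then show "AE \<omega> in M. norm (outer (X \<omega>) (Y \<omega>)) \<le>
      norm (real CARD('k) * (real CARD('k) * ((norm (X \<omega>))\<^sup>2 + (norm (Y \<omega>))\<^sup>2)))"
    by (auto simp: abs_mult)
qed

lemma (in prob_space) mmse_eq_cov_plus_bias:
  fixes T :: "'a \<Rightarrow> real^'k"
  assumes T: "square_integrable_rv M T"
  shows "mmse M T \<theta> = cov_matrix M T + outer (bias M T \<theta>) (bias M T \<theta>)"
proof -
  define \<mu> where "\<mu> = expectation T"
  define b where "b = bias M T \<theta>"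
  have m [measurable]: "T \<in> borel_measurable M"
    and s: "integrable M (\<lambda>\<omega>. (norm (T \<omega>))\<^sup>2)"
    using T by (auto simp: square_integrable_rv_def)
  have n: "integrable M (\<lambda>\<omega>. norm (T \<omega>))"
    by (rule square_integrable_imp_integrable[OF _ s]) measurable
  have i: "integrable M T" using n by (simp add: integrable_norm_iff)
  have "square_integrable_rv M (\<lambda>\<omega>. T \<omega> - \<mu>)"
    unfolding square_integrable_rv_def
  proof
    show "integrable M (\<lambda>\<omega>. (norm (T \<omega> - \<mu>))\<^sup>2)"
    proof (rule Bochner_Integration.integrable_bound)
      show "integrable M (\<lambda>\<omega>. 2 * (norm (T \<omega>))\<^sup>2 + 2 * (norm \<mu>)\<^sup>2)" using s by simp
      have "(norm (x - \<mu>))\<^sup>2 \<le> 2 * (norm x)\<^sup>2 + 2 * (norm \<mu>)\<^sup>2" for x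
      proof -
        have "(norm (x - \<mu>))\<^sup>2 \<le> (norm x + norm \<mu>)\<^sup>2"
          by (intro power_mono norm_triangle_ineq4) simp
        also have "\<dots> \<le> 2 * (norm x)\<^sup>2 + 2 * (norm \<mu>)\<^sup>2"
          using sum_squares_bound[of "norm x" "norm \<mu>"] by (simp add: power2_sum)
        finally show ?thesis .
      qed
      then show "AE \<omega> in M. norm ((norm (T \<omega> - \<mu>))\<^sup>2) \<le> norm (2 * (norm (T \<omega>))\<^sup>2 + 2 * (norm \<mu>)\<^sup>2)"
        by auto
    qed measurable
  qed measurable
  then have I1: "integrable M (\<lambda>\<omega>. outer (T \<omega> - \<mu>) (T \<omega> - \<mu>))"
    by (intro integrable_outer)
  have bl1: "bounded_linear (\<lambda>x. outer x b)"
    and bl2: "bounded_linear (\<lambda>x. outer b x)"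
    by (auto intro!: linear_conv_bounded_linear[THEN iffD1] linearI
        simp: outer_def vec_eq_iff algebra_simps)
  have i0: "integrable M (\<lambda>\<omega>. T \<omega> - \<mu>)" using i by simp
  have z: "expectation (\<lambda>\<omega>. T \<omega> - \<mu>) = 0" using i by (simp add: \<mu>_def prob_space)
  note I2 = integrable_bounded_linear[OF bl1 i0] integrable_bounded_linear[OF bl2 i0]
  have I3: "expectation (\<lambda>\<omega>. outer (T \<omega> - \<mu>) b) = 0" "expectation (\<lambda>\<omega>. outer b (T \<omega> - \<mu>)) = 0"
    using integral_bounded_linear[OF bl1 i0] integral_bounded_linear[OF bl2 i0]
    by (simp_all add: z linear_0[OF bounded_linear.linear[OF bl1]] linear_0[OF bounded_linear.linear[OF bl2]])
  have "outer (T \<omega> - \<theta>) (T \<omega> - \<theta>) =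
      outer (T \<omega> - \<mu>) (T \<omega> - \<mu>) + outer (T \<omega> - \<mu>) b + outer b (T \<omega> - \<mu>) + outer b b" for \<omega>
    by (simp add: b_def bias_def \<mu>_def outer_def vec_eq_iff algebra_simps)
  then have "mmse M T \<theta> = expectation (\<lambda>\<omega>. outer (T \<omega> - \<mu>) (T \<omega> - \<mu>)) + outer b b"
    unfolding mmse_def using I1 I2 I3 by (simp add: prob_space)
  then show ?thesis by (simp add: cov_matrix_def \<mu>_def b_def)
qed

end

theory Submission
  imports Defs
begin

text \<open>The restricted almost unbiased Liu estimator is an affine image
  \<open>L (I - G H) b + L G h\<close> of the MLE, where \<open>G = C\<inverse> H' W\<close> and \<open>W = (H C\<inverse> H')\<inverse>\<close>.
  Since \<open>H \<beta> = h\<close>, its mean is \<open>L \<beta>\<close>, so its bias is \<open>(L - I) \<beta>\<close>. Its covariance is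
  \<open>L (I - G H) C\<inverse> (I - G H)' L'\<close>; here \<open>L\<close> is symmetric, and \<open>W (H C\<inverse> H') W = W\<close>
  collapses the inner product to \<open>C\<inverse> - G H C\<inverse>\<close>.\<close>

section \<open>Matrix algebra: differences, transposes and inverses\<close>

lemma matrix_mult_diff_left: "(A - B) ** D = A ** D - B ** D"
  for A B :: "real^'n^'m" and D :: "real^'k^'n"
  by (simp add: matrix_matrix_mult_def vec_eq_iff left_diff_distrib sum_subtractf)

lemma matrix_mult_diff_right: "D ** (A - B) = D ** A - D ** B"
  for A B :: "real^'n^'m" and D :: "real^'m^'k"
  by (simp add: matrix_matrix_mult_def vec_eq_iff right_diff_distrib sum_subtractf)

lemma transpose_add: "transpose (A + B) = transpose A + transpose B"
  by (simp add: transpose_def vec_eq_iff)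

lemma transpose_diff: "transpose (A - B) = transpose A - transpose B"
  by (simp add: transpose_def vec_eq_iff)

text \<open>\<open>matrix_inv\<close> is a Hilbert choice; invertibility supplies the witness from
  which both equations follow.\<close>

lemma matrix_inv_inverse:
  assumes "invertible A"
  shows matrix_mult_matrix_inv: "A ** matrix_inv A = mat 1"
    and matrix_inv_mult_matrix: "matrix_inv A ** A = mat 1"
proof -
  have "A ** matrix_inv A = mat 1 \<and> matrix_inv A ** A = mat 1"
    unfolding matrix_inv_def by (rule someI_ex) (use assms in \<open>simp add: invertible_def\<close>)
  then show "A ** matrix_inv A = mat 1" "matrix_inv A ** A = mat 1" by auto
qed

text \<open>Transposing \<open>A ** matrix_inv A = mat 1\<close> shows that the transposed inverse
  is a left inverse of \<open>A\<close>, so it agrees with the right inverse.\<close>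

lemma transpose_matrix_inv_symmetric:
  fixes A :: "real^'n^'n"
  assumes "invertible A" "transpose A = A"
  shows "transpose (matrix_inv A) = matrix_inv A"
proof -
  have "transpose (matrix_inv A) = transpose (matrix_inv A) ** A ** matrix_inv A"
    by (simp add: matrix_mult_matrix_inv[OF assms(1)] flip: matrix_mul_assoc)
  also have "transpose (matrix_inv A) ** A = transpose (A ** matrix_inv A)"
    by (simp add: matrix_transpose_mul assms(2))
  finally show ?thesis by (simp add: matrix_mult_matrix_inv[OF assms(1)])
qed

section \<open>Symmetric positive definite matrices and the restricted covariance\<close>

lemma sym_pos_def_invertible:
  assumes "sym_pos_def C"
  shows "invertible C"
proof -
  have "x = 0" if "C *v x = 0" for x
    using assms that unfolding sym_pos_def_def by (metis inner_zero_right less_irrefl)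
  then show ?thesis
    by (simp add: invertible_left_inverse matrix_left_invertible_ker)
qed

text \<open>Writing \<open>x = C *v y\<close> turns the quadratic form of the inverse at
  \<open>x\<close> into that of \<open>C\<close> at \<open>y\<close>.\<close>

lemma sym_pos_def_matrix_inv:
  assumes "sym_pos_def C"
  shows "sym_pos_def (matrix_inv C)"
  unfolding sym_pos_def_def
proof (intro conjI allI impI)
  note inv = sym_pos_def_invertible[OF assms]
  show "transpose (matrix_inv C) = matrix_inv C"
    using assms by (simp add: transpose_matrix_inv_symmetric inv sym_pos_def_def)
  fix x :: "real^'a" assume "x \<noteq> 0"
  define y where "y = matrix_inv C *v x"
  have x: "x = C *v y"
    by (simp add: y_def matrix_vector_mul_assoc matrix_mult_matrix_inv[OF inv])
  with \<open>x \<noteq> 0\<close> have "y \<noteq> 0" by auto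
  then have "0 < y \<bullet> (C *v y)" using assms by (simp add: sym_pos_def_def)
  then show "0 < x \<bullet> (matrix_inv C *v x)"
    by (simp add: x[symmetric] y_def[symmetric] inner_commute)
qed

text \<open>The form at \<open>x\<close> is that of \<open>S\<close> at
  \<open>transpose H *v x\<close>, which is nonzero because full row rank of \<open>H\<close> makes
  its transpose injective. With \<open>S\<close> the inverse of \<open>C\<close>, this makes the
  matrix inverted in \<open>rmle\<close> invertible.\<close>

lemma sym_pos_def_congruence:
  fixes S :: "real^'k^'k" and H :: "real^'k^'q"
  assumes "sym_pos_def S" "rank H = CARD('q)"
  shows "sym_pos_def (H ** S ** transpose H)"
  unfolding sym_pos_def_def
proof (intro conjI allI impI)
  show "transpose (H ** S ** transpose H) = H ** S ** transpose H"
    using assms by (simp add: matrix_transpose_mul matrix_mul_assoc sym_pos_def_def)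
  fix x :: "real^'q" assume "x \<noteq> 0"
  have "inj ((*v) (transpose H))"
    using assms(2) by (simp only: rank_transpose flip: full_rank_injective)
  then have "transpose H *v x \<noteq> 0"
    using \<open>x \<noteq> 0\<close> by (metis injD matrix_vector_mult_0_right)
  then have "0 < (transpose H *v x) \<bullet> (S *v (transpose H *v x))"
    using assms(1) unfolding sym_pos_def_def by blast
  also have "\<dots> = x \<bullet> (H *v (S *v (transpose H *v x)))"
    by (simp add: dot_lmul_matrix)
  finally show "0 < x \<bullet> (H ** S ** transpose H *v x)"
    by (simp only: matrix_vector_mul_assoc matrix_mul_assoc)
qed

lemma sym_pos_def_add_mat_1:
  assumes "sym_pos_def C"
  shows "sym_pos_def (C + mat 1)"
  using assms unfolding sym_pos_def_def
  by (auto simp: transpose_add matrix_vector_mult_add_rdistrib inner_add_right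
      intro!: add_pos_pos)

text \<open>The factor is a polynomial in the symmetric matrix
  \<open>matrix_inv (C + mat 1)\<close>. This is why the covariance term of the theorem carries no
  transpose on its right factor.\<close>

lemma transpose_raule_factor:
  assumes "sym_pos_def C"
  shows "transpose (raule_factor C d) = raule_factor C d"
  using sym_pos_def_matrix_inv[OF sym_pos_def_add_mat_1[OF assms]]
  by (simp add: raule_factor_def sym_pos_def_def transpose_diff transpose_scalar
      matrix_transpose_mul)

text \<open>\<open>P\<close> is the linear part of the restricted estimator, so the right-hand side
  is the covariance of that estimator when the MLE has covariance
  \<open>matrix_inv C\<close>.\<close>

lemma restr_cov_eq_congruence:
  fixes C :: "real^'k^'k" and H :: "real^'k^'q"
  assumes "sym_pos_def C" "rank H = CARD('q)"
  defines "P \<equiv> mat 1 - matrix_inv C ** transpose H **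
                 matrix_inv (H ** matrix_inv C ** transpose H) ** H"
  shows "restr_cov C H = P ** matrix_inv C ** transpose P"
proof -
  define S where "S = matrix_inv C"
  define K where "K = H ** S ** transpose H"
  define W where "W = matrix_inv K"
  have S: "sym_pos_def S" unfolding S_def by (rule sym_pos_def_matrix_inv) fact
  have K: "sym_pos_def K" unfolding K_def by (rule sym_pos_def_congruence) fact+
  have W: "sym_pos_def W" unfolding W_def by (rule sym_pos_def_matrix_inv) fact
  have tr: "transpose S = S" "transpose W = W" using S W by (auto simp: sym_pos_def_def)
  \<comment> \<open>The middle of the product is \<open>K\<close>, and
    \<open>W ** K = mat 1\<close>.\<close>
  have WKW: "W ** H ** S ** transpose H ** W = W"
    using matrix_inv_mult_matrix[OF sym_pos_def_invertible[OF K]]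
    by (simp add: matrix_mul_assoc W_def K_def)
  define Q where "Q = S ** transpose H ** W ** H ** S"
  have "Q ** transpose H ** W ** H ** S = S ** transpose H ** (W ** H ** S ** transpose H ** W) ** H ** S"
    by (simp add: Q_def matrix_mul_assoc)
  also have "\<dots> = Q" by (simp only: WKW) (simp add: Q_def)
  finally have QQ: "Q ** transpose H ** W ** H ** S = Q" .
  have P: "P = mat 1 - S ** transpose H ** W ** H"
    by (simp add: P_def S_def W_def K_def)
  have "P ** S ** transpose P = (S - Q) ** (mat 1 - transpose H ** W ** H ** S)"
    by (simp add: P Q_def transpose_diff matrix_transpose_mul tr matrix_mult_diff_left matrix_mul_assoc)
  \<comment> \<open>Expansion gives \<open>S - Q - Q + Q\<close>: both mixed terms are
    \<open>Q\<close>, and the quadratic one is \<open>Q\<close> by \<open>QQ\<close>.\<close>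
  also have "\<dots> = S - Q"
    by (simp add: matrix_mult_diff_left matrix_mult_diff_right matrix_mul_assoc QQ)
       (simp add: Q_def)
  finally show ?thesis
    by (simp add: restr_cov_def S_def W_def K_def Q_def)
qed

section \<open>Affine images of random vectors: integrability, mean and covariance\<close>

lemma outer_matrix_vector_mult: "outer (F *v x) (F *v x) = F ** outer x x ** transpose F"
  for F :: "real^'m^'n"
proof -
  have "F ** outer x x = outer (F *v x) x"
    by (simp add: outer_def matrix_matrix_mult_def matrix_vector_mult_def vec_eq_iff
        sum_distrib_right mult.assoc)
  moreover have "outer (F *v x) x ** transpose F = outer (F *v x) (F *v x)"
    by (simp add: outer_def matrix_matrix_mult_def matrix_vector_mult_def transpose_def vec_eq_iff
        sum_distrib_left mult_ac)
  ultimately show ?thesis by simp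
qed

text \<open>Boundedness lets the congruence by \<open>F\<close> pass through the Bochner integral
  that defines the covariance.\<close>

lemma bounded_linear_matrix_congruence:
  "bounded_linear (\<lambda>E. F ** E ** transpose F)" for F :: "real^'m^'n"
proof -
  have l: "linear (\<lambda>E :: real^'m^'m. F ** E)"
    by (rule linearI) (simp_all add: matrix_add_ldistrib matrix_scalar_ac flip: scalar_matrix_assoc)
  have r: "linear (\<lambda>E :: real^'m^'n. E ** transpose F)"
    by (rule linearI)
       (simp_all add: matrix_matrix_mult_def vec_eq_iff distrib_right sum.distrib sum_distrib_left mult.assoc)
  show ?thesis
    using linear_compose[OF l r] by (simp add: o_def linear_conv_bounded_linear)
qed

lemma (in prob_space) square_integrable_rv_imp_integrable:
  assumes "square_integrable_rv M X"
  shows "integrable M X"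
proof -
  have [measurable]: "X \<in> borel_measurable M" and s: "integrable M (\<lambda>\<omega>. (norm (X \<omega>))\<^sup>2)"
    using assms by (auto simp: square_integrable_rv_def)
  have "integrable M (\<lambda>\<omega>. norm (X \<omega>))"
    by (rule square_integrable_imp_integrable[OF _ s]) measurable
  then show ?thesis by (simp add: integrable_norm_iff)
qed

lemma (in prob_space) square_integrable_rv_affine:
  fixes X :: "'a \<Rightarrow> real^'k" and F :: "real^'k^'m"
  assumes "square_integrable_rv M X"
  shows "square_integrable_rv M (\<lambda>\<omega>. F *v X \<omega> + c)"
  unfolding square_integrable_rv_def
proof
  have X: "X \<in> borel_measurable M" and s: "integrable M (\<lambda>\<omega>. (norm (X \<omega>))\<^sup>2)"
    using assms by (auto simp: square_integrable_rv_def)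
  have "(\<lambda>\<omega>. F *v X \<omega>) \<in> borel_measurable M"
    by (rule borel_measurable_continuous_on[OF _ X])
       (simp add: linear_continuous_on)
  then show m: "(\<lambda>\<omega>. F *v X \<omega> + c) \<in> borel_measurable M" by simp
  obtain B where B: "\<And>x. norm (F *v x) \<le> norm x * B"
    using bounded_linear.bounded[OF matrix_vector_mul_bounded_linear[of F]] by blast
  \<comment> \<open>This is the triangle inequality followed by
    \<open>(u + v)\<^sup>2 \<le> 2 * u\<^sup>2 + 2 * v\<^sup>2\<close>; the bound is integrable
    since the measure is finite.\<close>
  have "(norm (F *v x + c))\<^sup>2 \<le> 2 * B\<^sup>2 * (norm x)\<^sup>2 + 2 * (norm c)\<^sup>2" for x
  proof -
    have "(norm (F *v x + c))\<^sup>2 \<le> (norm x * B + norm c)\<^sup>2"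
      by (intro power_mono order_trans[OF norm_triangle_ineq] add_right_mono B) simp
    also have "\<dots> \<le> 2 * B\<^sup>2 * (norm x)\<^sup>2 + 2 * (norm c)\<^sup>2"
      using sum_squares_bound[of "norm x * B" "norm c"]
      by (simp add: power2_sum power_mult_distrib mult_ac)
    finally show ?thesis .
  qed
  then have bound: "AE \<omega> in M. norm ((norm (F *v X \<omega> + c))\<^sup>2)
      \<le> norm (2 * B\<^sup>2 * (norm (X \<omega>))\<^sup>2 + 2 * (norm c)\<^sup>2)"
    by simp
  show "integrable M (\<lambda>\<omega>. (norm (F *v X \<omega> + c))\<^sup>2)"
    by (rule Bochner_Integration.integrable_bound[OF _ _ bound]) (use m s in simp_all)
qed

lemma (in prob_space) expectation_affine:
  fixes X :: "'a \<Rightarrow> real^'k" and F :: "real^'k^'m"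
  assumes "integrable M X"
  shows "expectation (\<lambda>\<omega>. F *v X \<omega> + c) = F *v expectation X + c"
  using integrable_bounded_linear[OF matrix_vector_mul_bounded_linear assms, of F]
    integral_bounded_linear[OF matrix_vector_mul_bounded_linear assms, of F]
  by (simp add: prob_space)

text \<open>Centering cancels \<open>c\<close> and leaves \<open>F *v (X \<omega> - \<mu>)\<close>;
  its outer product is a congruence by \<open>F\<close>, which commutes with the
  expectation.\<close>

lemma (in prob_space) cov_matrix_affine:
  fixes X :: "'a \<Rightarrow> real^'k" and F :: "real^'k^'m"
  assumes "square_integrable_rv M X"
  shows "cov_matrix M (\<lambda>\<omega>. F *v X \<omega> + c) = F ** cov_matrix M X ** transpose F"
proof -
  define \<mu> where "\<mu> = expectation X"
  have i: "integrable M X" by (rule square_integrable_rv_imp_integrable) fact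
  have "square_integrable_rv M (\<lambda>\<omega>. X \<omega> - \<mu>)"
    using square_integrable_rv_affine[OF assms, of "mat 1" "- \<mu>"] by simp
  then have I: "integrable M (\<lambda>\<omega>. outer (X \<omega> - \<mu>) (X \<omega> - \<mu>))"
    by (intro integrable_outer)
  have "outer (F *v X \<omega> + c - (F *v \<mu> + c)) (F *v X \<omega> + c - (F *v \<mu> + c)) =
      F ** outer (X \<omega> - \<mu>) (X \<omega> - \<mu>) ** transpose F" for \<omega>
    by (simp add: matrix_vector_mult_diff_distrib flip: outer_matrix_vector_mult)
  then show ?thesis
    using integral_bounded_linear[OF bounded_linear_matrix_congruence I, of F]
    by (simp add: cov_matrix_def expectation_affine[OF i] flip: \<mu>_def)
qed

section \<open>Mean squared error of the restricted almost unbiased Liu estimator\<close>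

theorem proposition3p1:
  fixes M :: "'w measure"
    and bmle :: "'w \<Rightarrow> real^'k"
    and \<beta> :: "real^'k"
    and C :: "real^'k^'k"
    and H :: "real^'k^'q"
    and h :: "real^'q"
    and d :: real
  assumes "prob_space M"
    and "sym_pos_def C"
    and "square_integrable_rv M bmle"
    and "prob_space.expectation M bmle = \<beta>"
    and "cov_matrix M bmle = matrix_inv C"
    and "rank H = CARD('q)"
    and "H *v \<beta> = h"
    and "0 < d" and "d < 1"
  shows "mmse M (\<lambda>\<omega>. raule C H h d (bmle \<omega>)) \<beta> =
      raule_factor C d ** restr_cov C H ** raule_factor C d +
      (raule_factor C d - mat 1) ** outer \<beta> \<beta> ** transpose (raule_factor C d - mat 1)"
proof -
  interpret prob_space M by fact
  define L where "L = raule_factor C d"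
  define G where "G = matrix_inv C ** transpose H ** matrix_inv (H ** matrix_inv C ** transpose H)"
  define P where "P = mat 1 - G ** H"
  define T where "T = (\<lambda>\<omega>. raule C H h d (bmle \<omega>))"
  have T: "T = (\<lambda>\<omega>. (L ** P) *v bmle \<omega> + L *v (G *v h))"
    by (simp add: T_def raule_def rmle_def P_def algebra_simps
        flip: L_def G_def matrix_vector_mul_assoc)
  have sq: "square_integrable_rv M T"
    unfolding T by (rule square_integrable_rv_affine) fact
  have "expectation T = (L ** P) *v \<beta> + L *v (G *v h)"
    unfolding T using expectation_affine[OF square_integrable_rv_imp_integrable[OF assms(3)]] assms(4)
    by simp
  \<comment> \<open>Since \<open>H *v \<beta> = h\<close>, \<open>P *v \<beta>\<close> is
    \<open>\<beta> - G *v h\<close>, and the constant part of \<open>T\<close> restores the missing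
    \<open>L *v (G *v h)\<close>.\<close>
  also have "\<dots> = L *v \<beta>"
    using assms(7) by (simp add: P_def algebra_simps flip: matrix_vector_mul_assoc)
  finally have bias: "bias M T \<beta> = (L - mat 1) *v \<beta>"
    by (simp add: bias_def algebra_simps)
  have "cov_matrix M T = L ** P ** matrix_inv C ** transpose (L ** P)"
    unfolding T cov_matrix_affine[OF assms(3)] assms(5) ..
  also have "\<dots> = L ** (P ** matrix_inv C ** transpose P) ** L"
    using transpose_raule_factor[OF assms(2), of d]
    by (simp add: matrix_transpose_mul matrix_mul_assoc L_def)
  also have "P ** matrix_inv C ** transpose P = restr_cov C H"
    using restr_cov_eq_congruence[OF assms(2,6)] by (simp add: P_def G_def)
  \<comment> \<open>Covariance and bias are now combined; the outer square of
    \<open>(L - mat 1) *v \<beta>\<close> is rewritten as a congruence of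
    \<open>outer \<beta> \<beta>\<close>.\<close>
  finally show ?thesis
    using mmse_eq_cov_plus_bias[OF sq, of \<beta>]
    unfolding bias outer_matrix_vector_mult by (simp only: T_def L_def)
qed

end
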